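(* Let $\mathbb A = (A,+)$ be a cancellative (not necessarily commutative) semigroup and let $X, Y$ be subsets of $A$. Then $$|X+Y| \ge \min(\gamma(X+Y),\, |X|+|Y|-1).$$
   Context: A semigroup $\mathbb A=(A,+)$ is a set $A$ with an associative binary operation $+$ (written additively, but not assumed commutative; no identity is assumed). An element $z\in A$ is cancellable if, for all $x,y\in A$, $x+z=y+z$ implies $x=y$ and $z+x=z+y$ implies $x=y$; $\mathbb A$ is cancellative if every element of $A$ is cancellable. $\mathbb A^\times$ is the set of units of $\mathbb A$: if $\mathbb A$ has an identity $0$ (i.e. is a monoid), a unit is an element $z\in A$ for which there is a (unique) $-z\in A$ with $z+(-z)=(-z)+z=0$; if $\mathbb A$ has no identity, $\mathbb A^\times:=\emptyset$. For $Z\subseteq A$, $Z^\times := Z\cap \mathbb A^\times$. For $x\in A$ and a unit $x_0$, $x-x_0 := x+(-x_0)$. For sets, $X+Y:=\{x+y : x\in X, y\in Y\}$. $|X|$ is the number of elements of $X$ if $X$ is finite and $|X|:=\infty$ otherwise. For $z\in A$, $\operatorname{ord}(z)$ is the cardinality $|\langle\{z\}\rangle|$ of the subsemigroup generated by $z$. For $X\subseteq A$, $$\gamma(X):=\sup_{x_0\in X^\times}\ \inf_{x_0\ne x\in X}\operatorname{ord}(x-x_0)\in\mathbf N\cup\{\infty\},$$ where $\mathbf N$ is the set of non-negative integers, with the conventions $\sup\emptyset=0$ and $\inf\emptyset=\infty$. *)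

theory Defs
  imports Complex_Main "HOL-Library.Extended_Nat" "HOL-Library.Set_Algebras"
begin

definition ecard :: "'a set \<Rightarrow> enat" where
  "ecard X = (if finite X then enat (card X) else \<infinity>)"

(* The type class semigroup_add provides no identity element, so the identity has to be
   quantified explicitly. It is unique if it exists; if there is none, the set of units
   is empty. *)

definition add_inverse_of :: "'a::semigroup_add \<Rightarrow> 'a \<Rightarrow> bool" where
  "add_inverse_of z w \<longleftrightarrow> (\<exists>e. monoid (+) e \<and> z + w = e \<and> w + z = e)"

definition add_units :: "'a::semigroup_add set" where
  "add_units = {z. \<exists>w. add_inverse_of z w}"

lemma identity_unique:
  fixes e e' :: "'a::semigroup_add"
  assumes "monoid (+) e" "monoid (+) e'"
  shows "e = e'"
  using monoid.right_neutral[OF assms(2), of e] monoid.left_neutral[OF assms(1), of e'] by simp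

lemma add_inverse_of_unique:
  assumes "add_inverse_of z w" "add_inverse_of z w'"
  shows "w = w'"
proof -
  obtain e where e: "monoid (+) e" "w + z = e"
    using assms(1) by (auto simp: add_inverse_of_def)
  obtain e' where e': "monoid (+) e'" "z + w' = e'"
    using assms(2) by (auto simp: add_inverse_of_def)
  have "w = w + (z + w')"
    using monoid.right_neutral[OF e'(1)] e'(2) by simp
  also have "\<dots> = (w + z) + w'"
    by (simp only: add.assoc)
  also have "\<dots> = w'"
    using monoid.left_neutral[OF e(1)] e(2) by simp
  finally show ?thesis .
qed

(* Arbitrary unless z is a unit. *)

definition unit_neg :: "'a::semigroup_add \<Rightarrow> 'a" where
  "unit_neg z = (THE w. add_inverse_of z w)"

lemma add_inverse_of_unit_neg:
  assumes "z \<in> add_units"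
  shows "add_inverse_of z (unit_neg z)"
proof -
  have "\<exists>!w. add_inverse_of z w"
    using assms add_inverse_of_unique by (auto simp: add_units_def)
  then show ?thesis
    unfolding unit_neg_def by (rule theI')
qed

definition unit_diff :: "'a::semigroup_add \<Rightarrow> 'a \<Rightarrow> 'a" where
  "unit_diff x x0 = x + unit_neg x0"

inductive_set subsemigroup_gen :: "'a::semigroup_add set \<Rightarrow> 'a set" for S where
  incl: "x \<in> S \<Longrightarrow> x \<in> subsemigroup_gen S"
| add: "x \<in> subsemigroup_gen S \<Longrightarrow> y \<in> subsemigroup_gen S \<Longrightarrow> x + y \<in> subsemigroup_gen S"

definition add_ord :: "'a::semigroup_add \<Rightarrow> enat" where
  "add_ord z = ecard (subsemigroup_gen {z})"

(* In enat, Sup {} = 0 and Inf {} = \<infinity>. *)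

definition cd_gamma :: "'a::semigroup_add set \<Rightarrow> enat" where
  "cd_gamma X = (SUP x0 \<in> X \<inter> add_units. INF x \<in> X - {x0}. add_ord (unit_diff x x0))"

lemma cd_gamma_no_units: "X \<inter> add_units = {} \<Longrightarrow> cd_gamma X = 0"
  by (simp add: cd_gamma_def bot_enat_def)

end

(* After translating by units one may assume that the identity e lies in X and in Y. If e is the
   only common element, then X + Y contains X \<union> Y and the bound is clear. Otherwise pick a common
   element z distinct from e. Each of the transforms
     X \<union> (X + z), {y \<in> Y. z + y \<in> Y}   and   {x \<in> X. x + z \<in> X}, Y \<union> (z + Y)
   keeps e in both sets and does not enlarge the sumset, and since their effects on |X| + |Y| are
   opposite, one of them does not decrease |X| + |Y|. The process stops when X + z \<subseteq> X or
   z + Y \<subseteq> Y, but then X + Y contains all positive multiples of z. *)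

theory Submission
  imports Defs
begin

text \<open>\<open>A\<close> meets its image in the image of the second set, so by
  inclusion-exclusion the gain of \<open>A\<close> in one transform equals its loss in the
  other.\<close>

lemma card_shift_transform:
  assumes "finite A" "inj f"
  shows "card (A \<union> f ` A) + card {a \<in> A. f a \<in> A} = 2 * card A"
proof -
  have "card (A \<union> f ` A) + card (A \<inter> f ` A) = card A + card (f ` A)"
    using card_Un_Int[of A "f ` A"] assms by simp
  moreover have "A \<inter> f ` A = f ` {a \<in> A. f a \<in> A}"
    by auto
  ultimately show ?thesis
    using assms by (simp add: card_image inj_on_subset[OF _ subset_UNIV])
qed

lemma card_less_shift_Un:
  assumes "finite A" "\<not> f ` A \<subseteq> A"
  shows "card A < card (A \<union> f ` A)"
  using assms by (intro psubset_card_mono) auto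

lemma subsemigroup_gen_singleton_subset_right:
  fixes z :: "'a::semigroup_add"
  assumes "monoid (+) e" "e \<in> X" "\<And>x. x \<in> X \<Longrightarrow> x + z \<in> X"
  shows "subsemigroup_gen {z} \<subseteq> X"
proof
  fix t assume "t \<in> subsemigroup_gen {z}"
  \<comment> \<open>The induction needs the claim for every \<open>x\<close>; its case
    \<open>x = e\<close> gives the inclusion.\<close>
  then have "\<forall>x \<in> X. x + t \<in> X"
    by induction (use assms(3) in \<open>auto simp flip: add.assoc\<close>)
  then show "t \<in> X"
    using assms(2) monoid.left_neutral[OF assms(1)] by metis
qed

lemma subsemigroup_gen_singleton_subset_left:
  fixes z :: "'a::semigroup_add"
  assumes "monoid (+) e" "e \<in> Y" "\<And>y. y \<in> Y \<Longrightarrow> z + y \<in> Y"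
  shows "subsemigroup_gen {z} \<subseteq> Y"
proof
  fix t assume "t \<in> subsemigroup_gen {z}"
  then have "\<forall>y \<in> Y. t + y \<in> Y"
    by induction (use assms(3) in \<open>auto simp: add.assoc\<close>)
  then show "t \<in> Y"
    using assms(2) monoid.right_neutral[OF assms(1)] by metis
qed

lemma summands_subset_sumset:
  fixes X Y :: "'a::semigroup_add set"
  assumes "monoid (+) e" "e \<in> X" "e \<in> Y"
  shows "X \<subseteq> X + Y" "Y \<subseteq> X + Y"
proof -
  show "X \<subseteq> X + Y"
    using set_plus_intro[OF _ assms(3)] monoid.right_neutral[OF assms(1)] by (metis subsetI)
  show "Y \<subseteq> X + Y"
    using set_plus_intro[OF assms(2)] monoid.left_neutral[OF assms(1)] by (metis subsetI)
qed

text \<open>\<open>S\<close> serves as a fixed bound for the sumset: the transforms may shrink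
  \<open>X + Y\<close>, while the hypothesis on generated subsemigroups keeps speaking of the same
  set.\<close>

lemma card_add_card_le_of_sumset_subset:
  fixes X Y S :: "'a::cancel_semigroup_add set"
  assumes e: "monoid (+) e"
    and S: "finite S" "\<And>z. z \<in> S \<Longrightarrow> z \<noteq> e \<Longrightarrow> \<not> subsemigroup_gen {z} \<subseteq> S"
    and "e \<in> X" "e \<in> Y" "X + Y \<subseteq> S"
  shows "card X + card Y \<le> card S + 1"
  using assms(4-)
\<comment> \<open>Lexicographic descent: \<open>card X + card Y\<close> grows, or it stays and
  \<open>card X\<close> grows. Both sets lie in \<open>S\<close>, so the truncated subtractions
  register the growth.\<close>
proof (induction "(X, Y)" arbitrary: X Y
    rule: wf_induct_rule[OF wf_measures[of
      "[\<lambda>(X, Y). 2 * card S - (card X + card Y), \<lambda>(X, Y). card S - card X]"]])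
  case (1 X Y)
  note XY = \<open>e \<in> X\<close> \<open>e \<in> Y\<close> \<open>X + Y \<subseteq> S\<close>
  have in_S: "x + y \<in> S" if "x \<in> X" "y \<in> Y" for x y
    using XY that by (auto simp: set_plus_def)
  have sub: "X \<subseteq> S" "Y \<subseteq> S"
    using summands_subset_sumset[OF e XY(1,2)] XY(3) by auto
  have fin: "finite X" "finite Y"
    using sub S(1) finite_subset by auto
  have sub_card: "card A \<le> card S" if "A \<subseteq> S" for A
    using S(1) that by (rule card_mono)
  show ?case
  proof (cases "X \<inter> Y \<subseteq> {e}")
    case True
    then have "X \<inter> Y = {e}"
      using XY by auto
    then have "card X + card Y = card (X \<union> Y) + 1"
      using card_Un_Int[OF fin] by simp
    then show ?thesis
      using sub_card[of "X \<union> Y"] sub by simp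
  next
    case False
    then obtain z where z: "z \<in> X" "z \<in> Y" "z \<noteq> e"
      by auto
    define X1 where "X1 = X \<union> (\<lambda>x. x + z) ` X"
    define Y1 where "Y1 = {y \<in> Y. z + y \<in> Y}"
    define X2 where "X2 = {x \<in> X. x + z \<in> X}"
    define Y2 where "Y2 = Y \<union> (\<lambda>y. z + y) ` Y"
    have no_gen: "\<not> subsemigroup_gen {z} \<subseteq> S"
      using S(2) z sub by auto
    have "\<not> (\<lambda>x. x + z) ` X \<subseteq> X"
      using no_gen subsemigroup_gen_singleton_subset_right[OF e \<open>e \<in> X\<close>, of z] sub by blast
    then have grow1: "card X < card X1"
      unfolding X1_def by (rule card_less_shift_Un[OF fin(1)])
    have sumX: "card X1 + card X2 = 2 * card X"
      unfolding X1_def X2_def using fin(1) by (intro card_shift_transform) (auto intro: injI)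
    have sumY: "card Y2 + card Y1 = 2 * card Y"
      unfolding Y1_def Y2_def using fin(2) by (intro card_shift_transform) (auto intro: injI)
    \<comment> \<open>Here \<open>z\<close> must be common: \<open>z \<in> Y\<close> puts
      \<open>e\<close> into \<open>Y1\<close>, and \<open>z \<in> X\<close> puts it into
      \<open>X2\<close>.\<close>
    have mem: "e \<in> X1" "e \<in> Y1" "e \<in> X2" "e \<in> Y2"
      using XY z by (auto simp: X1_def Y1_def X2_def Y2_def
          monoid.left_neutral[OF e] monoid.right_neutral[OF e])
    \<comment> \<open>\<open>(x + z) + y = x + (z + y)\<close>, where \<open>z + y \<in> Y\<close>
      by the choice of \<open>Y1\<close>; symmetrically for \<open>X2\<close> and
      \<open>Y2\<close>.\<close>
    have sum1: "X1 + Y1 \<subseteq> S"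
      using in_S by (auto simp: X1_def Y1_def set_plus_def add.assoc)
    have sum2: "X2 + Y2 \<subseteq> S"
      using in_S by (auto simp: X2_def Y2_def set_plus_def simp flip: add.assoc)
    have le: "card X1 \<le> card S" "card Y1 \<le> card S" "card X2 \<le> card S" "card Y2 \<le> card S"
      using summands_subset_sumset[OF e mem(1,2)] summands_subset_sumset[OF e mem(3,4)] sum1 sum2
      by (auto intro!: sub_card)
    show ?thesis
    \<comment> \<open>A tie goes to the first transform, where \<open>grow1\<close> lowers the
      second measure; the other transform is taken only when it strictly raises the sum of
      cardinalities.\<close>
    proof (cases "card X + card Y \<le> card X1 + card Y1")
      case True
      then have "card X1 + card Y1 \<le> card S + 1"
        using grow1 le by (intro 1(1) mem sum1) auto
      then show ?thesis
        using True by simp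
    next
      case False
      then have "card X + card Y < card X2 + card Y2"
        using sumX sumY by linarith
      moreover from this have "card X2 + card Y2 \<le> card S + 1"
        using le by (intro 1(1) mem sum2) auto
      ultimately show ?thesis
        by simp
    qed
  qed
qed

lemma ecard_mono: "A \<subseteq> B \<Longrightarrow> ecard A \<le> ecard B"
  by (auto simp: ecard_def card_mono dest: finite_subset)

lemma ecard_image: "inj_on f A \<Longrightarrow> ecard (f ` A) = ecard A"
  by (simp add: ecard_def card_image finite_image_iff)

text \<open>Conjugation embeds one cyclic subsemigroup in the other: \<open>a + a'\<close> vanishes
  between adjacent terms, and cancellation makes the map injective.\<close>

lemma add_ord_le_conjugate:
  fixes a a' u :: "'a::cancel_semigroup_add"
  assumes e: "monoid (+) e" "a + a' = e"
  shows "add_ord u \<le> add_ord (a' + u + a)"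
proof -
  have "a' + t + a \<in> subsemigroup_gen {a' + u + a}" if "t \<in> subsemigroup_gen {u}" for t
    using that
  proof induction
    case (add x y)
    have "(a' + x + a) + (a' + y + a) = a' + x + (a + a') + y + a"
      by (simp only: add.assoc)
    also have "\<dots> = a' + (x + y) + a"
      by (simp only: e(2) monoid.right_neutral[OF e(1)] add.assoc[of a' x y])
    finally show ?case
      using subsemigroup_gen.add[OF add.IH] by simp
  qed (auto intro: subsemigroup_gen.incl)
  moreover have "inj (\<lambda>t. a' + t + a)"
    by (auto intro: injI)
  ultimately show ?thesis
    unfolding add_ord_def
    by (subst ecard_image[of "\<lambda>t. a' + t + a", symmetric]) (auto intro!: ecard_mono intro: inj_on_subset)
qed

text \<open>Cancel \<open>a\<close> in \<open>a + (b + a) = (a + b) + a = a + e\<close>.\<close>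

lemma cancel_right_inverse_imp_left_inverse:
  fixes a b :: "'a::cancel_semigroup_add"
  assumes "monoid (+) e" "a + b = e"
  shows "b + a = e"
proof -
  have "a + (b + a) = a + e"
    using assms(2) monoid.left_neutral[OF assms(1)] monoid.right_neutral[OF assms(1)]
    by (simp flip: add.assoc)
  then show ?thesis
    by simp
qed

theorem theorem7:
  fixes X Y :: "'a::cancel_semigroup_add set"
  shows "ecard (X + Y) \<ge> min (cd_gamma (X + Y)) (ecard X + ecard Y - 1)"
proof (rule ccontr)
  assume "\<not> ?thesis"
  then have gamma: "ecard (X + Y) < cd_gamma (X + Y)"
    and small: "ecard (X + Y) < ecard X + ecard Y - 1"
    by (auto simp: not_le)
  have fin: "finite (X + Y)"
    using gamma by (auto simp: ecard_def split: if_splits)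
  \<comment> \<open>A value strictly below the supremum is already exceeded at a single unit
    \<open>z0\<close>.\<close>
  obtain z0 where z0: "z0 \<in> X + Y" "z0 \<in> add_units"
    and ord0: "ecard (X + Y) < (INF z \<in> X + Y - {z0}. add_ord (unit_diff z z0))"
    using gamma unfolding cd_gamma_def less_SUP_iff by auto
  define w where "w = unit_neg z0"
  have ord: "ecard (X + Y) < add_ord (z + w)" if "z \<in> X + Y" "z \<noteq> z0" for z
    using less_le_trans[OF ord0 INF_lower, of z] that by (simp add: unit_diff_def w_def)
  obtain a b where ab: "a \<in> X" "b \<in> Y" "z0 = a + b"
    using z0(1) by (auto simp: set_plus_def)
  obtain e where e: "monoid (+) e" and w: "a + b + w = e" "w + (a + b) = e"
    using add_inverse_of_unit_neg[OF z0(2)] by (auto simp: add_inverse_of_def w_def ab(3))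
  \<comment> \<open>Translations by \<open>b\<close> and by \<open>a\<close> embed \<open>X\<close>
    and \<open>Y\<close> in the finite sumset.\<close>
  have finX: "finite X" and finY: "finite Y"
  proof -
    have "(\<lambda>x. x + b) ` X \<subseteq> X + Y" "(\<lambda>y. a + y) ` Y \<subseteq> X + Y"
      using ab by (auto simp: set_plus_def)
    then have "finite ((\<lambda>x. x + b) ` X)" "finite ((\<lambda>y. a + y) ` Y)"
      using fin by (simp_all add: finite_subset)
    then show "finite X" "finite Y"
      by (auto dest: finite_imageD simp: inj_on_def)
  qed
  \<comment> \<open>These are the inverses of \<open>a\<close> and \<open>b\<close>: both summands
    of the unit \<open>z0\<close> are units.\<close>
  define a' where "a' = b + w"
  define b' where "b' = w + a"
  have aa': "a + a' = e" "a' + a = e"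
    using w(1) cancel_right_inverse_imp_left_inverse[OF e, of a a']
    by (auto simp: a'_def add.assoc)
  have bb': "b + b' = e"
    using aa'(2) by (simp add: a'_def b'_def add.assoc)
  \<comment> \<open>Translating \<open>X\<close> by \<open>a'\<close> on the left and
    \<open>Y\<close> by \<open>b'\<close> on the right acts on sums as \<open>h\<close>, which sends
    \<open>z0\<close> to \<open>e\<close>. Since \<open>b' = w + a\<close>, \<open>h z\<close> is a
    conjugate of \<open>z + w\<close>, the difference of \<open>z\<close> and
    \<open>z0\<close>.\<close>
  define h where "h z = a' + z + b'" for z
  have h: "h z = a' + (z + w) + a" for z
    by (simp add: h_def b'_def add.assoc)
  have inj_h: "inj h"
    unfolding h_def by (auto intro: injI)
  have h_z0: "h z0 = e"
    using bb' by (simp add: h_def ab(3) aa'(2) monoid.left_neutral[OF e] flip: add.assoc)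
  define X' where "X' = (\<lambda>x. a' + x) ` X"
  define Y' where "Y' = (\<lambda>y. y + b') ` Y"
  have card': "card X' = card X" "card Y' = card Y" "card (h ` (X + Y)) = card (X + Y)"
    unfolding X'_def Y'_def using inj_h
    by (auto intro!: card_image simp: inj_on_def)
  have mem: "e \<in> X'" "e \<in> Y'"
    unfolding X'_def Y'_def using ab aa' bb' by (force intro: rev_image_eqI)+
  have sum: "X' + Y' \<subseteq> h ` (X + Y)"
  proof -
    have "(a' + x) + (y + b') = h (x + y)" for x y
      by (simp add: h_def add.assoc)
    then show ?thesis
      by (auto simp: X'_def Y'_def elim!: set_plus_elim)
  qed
  \<comment> \<open>The order of \<open>h z\<close> is at least that of \<open>z + w\<close>, hence
    exceeds the size of the sumset and of its image under \<open>h\<close>.\<close>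
  have no_gen: "\<not> subsemigroup_gen {h z} \<subseteq> h ` (X + Y)" if "z \<in> X + Y" "z \<noteq> z0" for z
  proof
    assume "subsemigroup_gen {h z} \<subseteq> h ` (X + Y)"
    then have "add_ord (h z) \<le> ecard (h ` (X + Y))"
      unfolding add_ord_def by (rule ecard_mono)
    moreover have "ecard (h ` (X + Y)) = ecard (X + Y)"
      using inj_h by (intro ecard_image) (auto intro: inj_on_subset)
    moreover have "add_ord (z + w) \<le> add_ord (h z)"
      unfolding h by (rule add_ord_le_conjugate[OF e aa'(1)])
    ultimately show False
      using ord[OF that] by simp
  qed
  have "card X' + card Y' \<le> card (h ` (X + Y)) + 1"
    using fin no_gen h_z0 by (intro card_add_card_le_of_sumset_subset[OF e _ _ mem sum]) auto
  then have "card X + card Y - 1 \<le> card (X + Y)"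
    using card' by simp
  then show False
    using small fin finX finY by (simp add: ecard_def one_enat_def)
qed

end
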